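(* An $\ell u$-frame $\langle G,u\rangle$ is algebraic if and only if it is isomorphic to $\langle\mathbb{Z}^X,\mathbf{n}\rangle$ for some set $X$ and some family $\mathbf{n}=(n_x)_{x\in X}$ of positive integers, where $\mathbb{Z}^X$ carries the coordinatewise group operations and order.
   Context: An $\ell u$-group $\langle G,u\rangle$ is an abelian lattice-ordered group with a strong unit $u\ge0$ (every $x$ satisfies $|x|\le nu$ for some integer $n\ge1$, where $|x|=x\vee-x$); an $\ell u$-frame is an $\ell u$-group whose group is complete (every nonempty bounded subset has a supremum and an infimum). $\Gamma(G,u)=[0,u]$ is the MV-algebra with $x\oplus y=(x+y)\wedge u$, $\neg x=u-x$. An element $a$ of a complete lattice $L$ is compact if whenever $a\le\bigvee S$ there is a finite $F\subseteq S$ with $a\le\bigvee F$. An element $g\in G$ is compact in $\langle G,u\rangle$ if $|g|\wedge u$ is a compact element of the complete MV-algebra $[0,u]$; $\mathfrak{k}(\langle G,u\rangle)$ denotes the set of such $g$. The $\ell u$-frame is algebraic if every $g\in G$ satisfies $g=\bigvee\{a\in\mathfrak{k}(\langle G,u\rangle):a\le g\}$. Isomorphism means a unit-preserving isomorphism of lattice-ordered groups. *)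

theory Defs
  imports "HOL-Library.Lattice_Algebras" "HOL-Library.Lub_Glb" "HOL-Library.FuncSet"
begin

text \<open>
  The underlying group of an l-u-group is a type of class
  \<^class>\<open>lattice_ab_group_add_abs\<close>: abelian lattice-ordered groups together with the
  defined operation \<open>\<bar>x\<bar> = sup x (- x)\<close>.  Only the unit \<open>u\<close> is an explicit parameter.
\<close>

text \<open>The iterated sum \<open>\<Sum>i<n. u\<close> is the multiple \<open>n u\<close> in the additive group.\<close>

definition lu_group :: "'a::lattice_ab_group_add_abs \<Rightarrow> bool" where
  "lu_group u \<longleftrightarrow> 0 \<le> u \<and> (\<forall>x. \<exists>n::nat. 1 \<le> n \<and> \<bar>x\<bar> \<le> (\<Sum>i<n. u))"

definition lu_frame :: "'a::lattice_ab_group_add_abs \<Rightarrow> bool" where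
  "lu_frame u \<longleftrightarrow> lu_group u \<and>
    (\<forall>S::'a set. S \<noteq> {} \<and> bdd_below S \<and> bdd_above S \<longrightarrow>
       (\<exists>s. isLub UNIV S s) \<and> (\<exists>i. isGlb UNIV S i))"

text \<open>
  Compactness in an ordered set given by its carrier \<open>L\<close>; all suprema are taken
  inside \<open>L\<close> (in particular, the empty supremum is the least element of \<open>L\<close>).
  It is meant for carriers that are complete lattices, where the suprema
  \<open>s\<close> and \<open>t\<close> exist and are unique.
\<close>

definition compact_in :: "'a::order set \<Rightarrow> 'a \<Rightarrow> bool" where
  "compact_in L a \<longleftrightarrow> a \<in> L \<and>
    (\<forall>S s. S \<subseteq> L \<and> isLub L S s \<and> a \<le> s \<longrightarrow>
       (\<exists>F t. F \<subseteq> S \<and> finite F \<and> isLub L F t \<and> a \<le> t))"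

text \<open>
  The interval \<open>{0..u}\<close> is the carrier of the MV-algebra \<open>\<Gamma>(G,u)\<close>; its lattice order
  is the restriction of the order of \<open>G\<close>.
\<close>

definition compact_elements :: "'a::lattice_ab_group_add_abs \<Rightarrow> 'a set" where
  "compact_elements u = {g. compact_in {0..u} (inf \<bar>g\<bar> u)}"

definition algebraic_lu :: "'a::lattice_ab_group_add_abs \<Rightarrow> bool" where
  "algebraic_lu u \<longleftrightarrow> (\<forall>g. isLub UNIV {a \<in> compact_elements u. a \<le> g} g)"

text \<open>
  The power \<open>\<int>\<^sup>X\<close> over a set \<open>X\<close> is represented by the extensional functions
  \<open>X \<rightarrow>\<^sub>E UNIV\<close> with values in \<^typ>\<open>int\<close>.  Its lattice operations for the coordinatewise
  order are coordinatewise \<^const>\<open>sup\<close> and \<^const>\<open>inf\<close>.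
\<close>

definition lu_iso_int_power ::
    "'a::lattice_ab_group_add_abs \<Rightarrow> 'x set \<Rightarrow> ('x \<Rightarrow> int) \<Rightarrow> ('a \<Rightarrow> 'x \<Rightarrow> int) \<Rightarrow> bool" where
  "lu_iso_int_power u X n \<phi> \<longleftrightarrow>
     bij_betw \<phi> UNIV (X \<rightarrow>\<^sub>E UNIV) \<and>
     (\<forall>a b. \<phi> (a + b) = (\<lambda>x\<in>X. \<phi> a x + \<phi> b x)) \<and>
     (\<forall>a b. \<phi> (sup a b) = (\<lambda>x\<in>X. sup (\<phi> a x) (\<phi> b x))) \<and>
     (\<forall>a b. \<phi> (inf a b) = (\<lambda>x\<in>X. inf (\<phi> a x) (\<phi> b x))) \<and>
     \<phi> u = (\<lambda>x\<in>X. n x)"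

lemma lu_iso_int_power_le_iff:
  assumes "lu_iso_int_power u X n \<phi>"
  shows "a \<le> b \<longleftrightarrow> (\<forall>x\<in>X. \<phi> a x \<le> \<phi> b x)"
proof -
  have inj: "inj \<phi>" and ext: "\<phi> b \<in> X \<rightarrow>\<^sub>E UNIV"
    and sup: "\<phi> (sup a b) = (\<lambda>x\<in>X. sup (\<phi> a x) (\<phi> b x))"
    using assms by (auto simp: lu_iso_int_power_def bij_betw_def)
  have "a \<le> b \<longleftrightarrow> \<phi> (sup a b) = \<phi> b"
    using inj by (simp add: inj_eq sup.absorb_iff2)
  also have "\<dots> \<longleftrightarrow> (\<lambda>x\<in>X. sup (\<phi> a x) (\<phi> b x)) = restrict (\<phi> b) X"
    using sup ext by (simp add: PiE_restrict)
  also have "\<dots> \<longleftrightarrow> (\<forall>x\<in>X. \<phi> a x \<le> \<phi> b x)"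
    by (auto simp: fun_eq_iff restrict_def sup_int_def)
  finally show ?thesis .
qed

text \<open>
  Every index set \<open>X\<close> of a power isomorphic to \<open>G\<close> injects into \<open>G\<close> (send \<open>x\<close> to the element
  corresponding to the indicator of \<open>x\<close>), so index sets \<open>X :: 'a set\<close> over the carrier type \<open>'a\<close>
  of \<open>G\<close> are fully general.
\<close>

definition iso_to_int_power ::
    "'a::lattice_ab_group_add_abs \<Rightarrow> 'x set \<Rightarrow> ('x \<Rightarrow> int) \<Rightarrow> bool" where
  "iso_to_int_power u X n \<longleftrightarrow> (\<exists>\<phi>. lu_iso_int_power u X n \<phi>)"

end

theory Submission
  imports Defs
begin

text \<open>
  Algebraicity applied to \<open>- u\<close> yields a compact \<open>a \<le> - u\<close>, so \<open>u = inf \<bar>a\<bar> u\<close> is compact in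
  \<open>{0..u}\<close>; translating by \<open>u - x\<close>, so is every \<open>x\<close> in \<open>{0..u}\<close>.  Hence every nonempty subset of
  \<open>{0..u}\<close> has a maximal element.  Therefore every positive element lies above an atom, there are
  only finitely many atoms, and they generate the group; as distinct atoms are disjoint, the
  group is freely generated by them, with the coordinatewise order.
  Conversely, the unit of a power of the integers can be strong only if the index set is finite.
  The interval \<open>{0..u}\<close> is then finite, so all elements are compact.
\<close>

section \<open>Compactness in the unit interval\<close>

lemma isLub_leI: "isLub L S s \<Longrightarrow> y \<in> L \<Longrightarrow> (\<And>x. x \<in> S \<Longrightarrow> x \<le> y) \<Longrightarrow> s \<le> y"
  by (auto simp: isLub_def leastP_def setge_def setle_def isUb_def)

lemma isLub_ge: "isLub L S s \<Longrightarrow> x \<in> S \<Longrightarrow> x \<le> s"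
  by (auto simp: isLub_def leastP_def setge_def setle_def isUb_def)

lemma isLub_mem: "isLub L S s \<Longrightarrow> s \<in> L"
  by (auto simp: isLub_def leastP_def isUb_def)

lemma isLub_I:
  "s \<in> L \<Longrightarrow> (\<And>x. x \<in> S \<Longrightarrow> x \<le> s) \<Longrightarrow> (\<And>y. y \<in> L \<Longrightarrow> (\<And>x. x \<in> S \<Longrightarrow> x \<le> y) \<Longrightarrow> s \<le> y)
    \<Longrightarrow> isLub L S s"
  by (auto simp: isLub_def leastP_def setge_def setle_def isUb_def)

lemma finite_isLub_interval:
  fixes a b :: "'a::lattice"
  assumes "finite F" "F \<subseteq> {a..b}" "a \<le> b"
  shows "\<exists>t. isLub {a..b} F t"
  using assms
proof (induction F rule: finite_induct)
  case empty
  then have "isLub {a..b} {} a"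
    by (intro isLub_I) auto
  then show ?case ..
next
  case (insert x F)
  then obtain t where t: "isLub {a..b} F t"
    by auto
  have "isLub {a..b} (insert x F) (sup x t)"
  proof (rule isLub_I)
    show "sup x t \<in> {a..b}"
      using insert.prems isLub_mem[OF t] by (auto intro: le_supI1)
    show "y \<le> sup x t" if "y \<in> insert x F" for y
      using that isLub_ge[OF t] by (auto intro: le_supI2)
    show "sup x t \<le> y" if "y \<in> {a..b}" "\<And>z. z \<in> insert x F \<Longrightarrow> z \<le> y" for y
      using that isLub_leI[OF t] by auto
  qed
  then show ?case ..
qed

text \<open>Translation by \<open>u - x\<close>, cut off at \<open>u\<close>, turns a nonempty
  family with supremum at least \<open>x\<close> into one with supremum \<open>u\<close>. A finite
  subfamily found there by compactness of \<open>u\<close> is translated back.\<close>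

lemma compact_in_interval_if_compact_top:
  fixes u :: "'a::lattice_ab_group_add"
  assumes u: "0 \<le> u" "compact_in {0..u} u" and x: "x \<in> {0..u}"
  shows "compact_in {0..u} x"
  unfolding compact_in_def
proof (intro conjI allI impI x, elim conjE)
  fix S s
  assume S: "S \<subseteq> {0..u}" and s: "isLub {0..u} S s" and xs: "x \<le> s"
  define h where "h = (\<lambda>y. inf (y + (u - x)) u)"
  \<comment> \<open>This settles empty \<open>S\<close>, which \<open>h\<close> cannot handle: its
    image is empty as well, so its supremum in the interval is \<open>0\<close>, which need not be
    \<open>u\<close>.\<close>
  have *: "\<exists>F t. F \<subseteq> S \<and> finite F \<and> isLub {0..u} F t \<and> x \<le> t" if "x \<le> 0"
  proof (intro exI conjI)
    show "isLub {0..u} {} 0"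
      using u by (intro isLub_I) auto
  qed (use that in auto)
  show "\<exists>F t. F \<subseteq> S \<and> finite F \<and> isLub {0..u} F t \<and> x \<le> t"
  proof (cases "S = {}")
    case True
    then have "s \<le> 0"
      using isLub_leI[OF s, of 0] u by auto
    then show ?thesis
      using * xs by auto
  next
    case False
    then obtain s0 where s0: "s0 \<in> S"
      by auto
    have h_mem: "h ` S \<subseteq> {0..u}"
      using S x by (auto simp: h_def subset_iff intro!: add_nonneg_nonneg)
    have "isLub {0..u} (h ` S) u"
    proof (rule isLub_I)
      fix y
      assume y: "y \<in> {0..u}" and ub: "\<And>z. z \<in> h ` S \<Longrightarrow> z \<le> y"
      have le: "s' \<le> y + s - u" if "s' \<in> S" for s'
      proof -
        let ?v = "s' + (u - x)"
        \<comment> \<open>This identity replaces infinite distributivity: it turns the bound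
          \<open>y\<close> on the truncated translates into the bound \<open>y + s - u\<close> on
          \<open>S\<close> itself.\<close>
        have "?v + u = inf ?v u + sup ?v u"
          using add_eq_inf_sup[of ?v u] by (simp add: ac_simps)
        also have "\<dots> \<le> y + (s + (u - x))"
        proof (rule add_mono)
          show "inf ?v u \<le> y"
            using ub that by (auto simp: h_def)
          show "sup ?v u \<le> s + (u - x)"
            using isLub_ge[OF s that] add_right_mono[OF xs, of "u - x"] by (auto intro: add_right_mono)
        qed
        finally show ?thesis
          by (simp add: algebra_simps)
      qed
      \<comment> \<open>The supremum \<open>s\<close> is least only among upper bounds in
        \<open>{0..u}\<close>, so \<open>y + s - u\<close> must be shown to lie there; nonnegativity
        comes from a member of \<open>S\<close>.\<close>
      have "0 \<le> s0"
        using s0 S by auto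
      then have "0 \<le> y + s - u"
        using le[OF s0] by order
      moreover have "y + s - u \<le> u"
        using add_mono[of y u s u] y isLub_mem[OF s] by (simp add: algebra_simps)
      ultimately have "s \<le> y + s - u"
        using le by (intro isLub_leI[OF s]) auto
      then show "u \<le> y"
        by (simp add: algebra_simps)
    qed (use u in \<open>auto simp: h_def\<close>)
    then obtain F' t' where F': "F' \<subseteq> h ` S" "finite F'" "isLub {0..u} F' t'" "u \<le> t'"
      using u(2) h_mem unfolding compact_in_def by (metis order_refl)
    then obtain F where F: "F \<subseteq> S" "finite F" "F' = h ` F"
      by (meson finite_subset_image)
    obtain t where t: "isLub {0..u} F t"
      using finite_isLub_interval[of F 0 u] F S u by auto
    have "t' \<le> inf (t + (u - x)) u"
    proof (rule isLub_leI[OF F'(3)])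
      show "inf (t + (u - x)) u \<in> {0..u}"
        using isLub_mem[OF t] x by (auto intro!: add_nonneg_nonneg)
      show "z \<le> inf (t + (u - x)) u" if "z \<in> F'" for z
        using that F(3) isLub_ge[OF t] by (auto simp: h_def intro: le_infI1)
    qed
    then have "u \<le> t + (u - x)"
      using F'(4) by (meson inf.boundedE order_trans)
    then have "x \<le> t"
      by (simp add: algebra_simps)
    then show ?thesis
      using F t by blast
  qed
qed

lemma compact_unit_if_algebraic:
  fixes u :: "'a::lattice_ab_group_add_abs"
  assumes "0 \<le> u" "algebraic_lu u"
  shows "compact_in {0..u} u"
proof (cases "\<exists>a\<in>compact_elements u. a \<le> - u")
  case True
  then obtain a where a: "compact_in {0..u} (inf \<bar>a\<bar> u)" "a \<le> - u"
    by (auto simp: compact_elements_def)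
  have "u \<le> - a"
    using a(2) by (simp add: le_minus_iff)
  then have "u \<le> \<bar>a\<bar>"
    by (simp add: abs_lattice le_supI2)
  then show ?thesis
    using a(1) by (simp add: inf_absorb2)
next
  case False
  \<comment> \<open>With nothing compact below \<open>- u\<close>, the element \<open>- u\<close> is
    the supremum of the empty set, hence least in the whole group. This forces \<open>u = 0\<close>,
    and the interval is a single point.\<close>
  then have "isLub UNIV {} (- u)"
    using assms(2) unfolding algebraic_lu_def
    by (metis (mono_tags, lifting) Collect_empty_eq)
  then have "- u \<le> - u - u"
    by (rule isLub_leI) auto
  then have "u = 0"
    using assms(1) by simp
  have "isLub {0..u} {} 0"
    using assms(1) by (intro isLub_I) auto
  then show ?thesis
    using \<open>u = 0\<close> unfolding compact_in_def by auto
qed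

text \<open>Completeness speaks of suprema in the group, compactness of suprema in the interval.
  They agree for nonempty \<open>S\<close>, whose members keep the supremum above
  \<open>0\<close>.\<close>

lemma lu_frame_isLub_interval:
  fixes u :: "'a::lattice_ab_group_add_abs"
  assumes frame: "lu_frame u" and S: "S \<subseteq> {0..u}" "S \<noteq> {}"
  obtains s where "isLub {0..u} S s"
proof -
  have "bdd_below S" "bdd_above S"
    using S(1) by (meson bdd_below_Icc bdd_above_Icc bdd_below_mono bdd_above_mono)+
  then obtain s where s: "isLub UNIV S s"
    using frame S(2) unfolding lu_frame_def by metis
  obtain x where x: "x \<in> S"
    using S(2) by auto
  have "0 \<le> s"
    using S(1) x isLub_ge[OF s x] by (meson atLeastAtMost_iff order_trans subsetD)
  moreover have "s \<le> u"
    using S(1) by (intro isLub_leI[OF s]) auto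
  ultimately have "isLub {0..u} S s"
    using isLub_ge[OF s] isLub_leI[OF s] by (intro isLub_I) auto
  then show ?thesis
    by (rule that)
qed

text \<open>Zorn's lemma applies because a nonempty chain contains an upper bound of itself: its
  supremum is compact, hence below the supremum of finitely many members, and these lie below a
  single member.\<close>

lemma maximal_exists:
  fixes u :: "'a::lattice_ab_group_add_abs"
  assumes frame: "lu_frame u" and comp: "compact_in {0..u} u"
    and Q: "Q \<subseteq> {0..u}" "Q \<noteq> {}"
  obtains m where "m \<in> Q" "\<And>x. x \<in> Q \<Longrightarrow> m \<le> x \<Longrightarrow> x = m"
proof -
  have u: "0 \<le> u"
    using frame by (simp add: lu_frame_def lu_group_def)
  have "\<exists>m\<in>Q. \<forall>x\<in>Q. m \<le> x \<longrightarrow> x = m"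
  proof (rule predicate_Zorn)
    show "partial_order_on Q (relation_of (\<le>) Q)"
      by (rule partial_order_on_relation_ofI) auto
    fix C
    assume C: "C \<in> Chains (relation_of (\<le>) Q)"
    then have CQ: "C \<subseteq> Q" and chain: "\<And>x y. x \<in> C \<Longrightarrow> y \<in> C \<Longrightarrow> x \<le> y \<or> y \<le> x"
      by (auto simp: Chains_def relation_of_def)
    show "\<exists>ub\<in>Q. \<forall>a\<in>C. a \<le> ub"
    proof (cases "C = {}")
      case True
      then show ?thesis
        using Q by auto
    next
      case False
      then obtain c where c: "c \<in> C"
        by auto
      have CL: "C \<subseteq> {0..u}"
        using CQ Q by auto
      then obtain s where s: "isLub {0..u} C s"
        using False by (rule lu_frame_isLub_interval[OF frame])
      note sL = isLub_mem[OF s]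
      obtain F t where F: "F \<subseteq> C" "finite F" "isLub {0..u} F t" "s \<le> t"
        using compact_in_interval_if_compact_top[OF u comp sL] CL s
        unfolding compact_in_def by blast
      have "\<exists>b\<in>C. \<forall>x\<in>F. x \<le> b"
        using F(2,1)
      proof (induction F rule: finite_induct)
        case empty
        then show ?case
          using c by auto
      next
        case (insert x F)
        then obtain b where "b \<in> C" "\<forall>x\<in>F. x \<le> b"
          by auto
        then show ?case
          using chain[of x b] insert.prems by (auto intro: order_trans)
      qed
      then obtain b where b: "b \<in> C" "\<And>x. x \<in> F \<Longrightarrow> x \<le> b"
        by auto
      have "t \<le> b"
        using b CL by (intro isLub_leI[OF F(3)]) auto
      then have "\<forall>a\<in>C. a \<le> b"
        using isLub_ge[OF s] F(4) by (meson order_trans)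
      then show ?thesis
        using b CQ by auto
    qed
  qed
  then show ?thesis
    using that by auto
qed

section \<open>Atoms\<close>

definition atom :: "'a::lattice_ab_group_add \<Rightarrow> bool" where
  "atom p \<longleftrightarrow> 0 < p \<and> (\<forall>y. 0 \<le> y \<and> y \<le> p \<longrightarrow> y = 0 \<or> y = p)"

text \<open>Subtracting \<open>z\<close> from \<open>inf x (y + z)\<close> leaves an element below
  both \<open>x\<close> and \<open>y\<close>, hence at most \<open>0\<close>. So
  \<open>inf x (y + z)\<close> is below both \<open>x\<close> and \<open>z\<close>.\<close>

lemma inf_add_eq_0:
  fixes x y z :: "'a::lattice_ab_group_add"
  assumes "0 \<le> x" "0 \<le> y" "0 \<le> z" "inf x y = 0" "inf x z = 0"
  shows "inf x (y + z) = 0"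
proof (rule antisym)
  let ?w = "inf x (y + z)"
  have "?w - z \<le> y"
    by (simp add: diff_le_eq)
  moreover have "?w - z \<le> x"
    using assms(3) by (simp add: diff_le_eq le_infI1 add_increasing2)
  ultimately have "?w - z \<le> inf x y"
    by simp
  then have "?w \<le> inf x z"
    using assms(4) by simp
  then show "?w \<le> 0"
    using assms(5) by simp
qed (use assms in simp)

lemma inf_sum_eq_0:
  fixes x :: "'a::lattice_ab_group_add"
  assumes "0 \<le> x" "\<And>i. i \<in> I \<Longrightarrow> 0 \<le> f i" "\<And>i. i \<in> I \<Longrightarrow> inf x (f i) = 0"
  shows "inf x (sum f I) = 0"
  using assms(2,3)
proof (induction I rule: infinite_finite_induct)
  case (insert i I)
  then show ?case
    by (auto intro!: inf_add_eq_0 assms(1) sum_nonneg)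
qed (use assms(1) in \<open>auto simp: inf_absorb2\<close>)

lemma inf_atoms_eq_0:
  assumes "atom p" "atom q" "p \<noteq> q"
  shows "inf p q = 0"
proof -
  have "0 \<le> inf p q"
    using assms by (simp add: atom_def order_less_imp_le)
  then have "inf p q = 0 \<or> inf p q = p" "inf p q = 0 \<or> inf p q = q"
    using assms by (auto simp: atom_def)
  then show ?thesis
    using assms(3) by auto
qed

text \<open>An atom not below \<open>u\<close> would be disjoint from \<open>u\<close>, hence from
  all its multiples, one of which lies above the atom because the unit is strong.\<close>

lemma atom_le_unit:
  assumes "lu_group u" "atom p"
  shows "p \<le> u"
proof -
  have p: "0 < p" and u: "0 \<le> u"
    using assms by (auto simp: atom_def lu_group_def)
  have "0 \<le> inf p u"
    using p u by simp
  then consider "inf p u = 0" | "inf p u = p"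
    using assms(2) unfolding atom_def by (meson inf_le1)
  then show ?thesis
  proof cases
    case 1
    obtain n :: nat where "\<bar>p\<bar> \<le> (\<Sum>i<n. u)"
      using assms(1) unfolding lu_group_def by blast
    then have "inf p (\<Sum>i<n. u) = p"
      using p by (simp add: inf_absorb1)
    moreover have "inf p (\<Sum>i<n. u) = 0"
      using p u 1 by (intro inf_sum_eq_0) auto
    ultimately show ?thesis
      using p by simp
  next
    case 2
    then show ?thesis
      by (simp add: le_iff_inf)
  qed
qed

text \<open>Complementation in \<open>g\<close> converts maximal elements into minimal positive
  ones: if \<open>m\<close> is maximal strictly below \<open>g\<close>, then \<open>g - m\<close> is
  an atom.\<close>

lemma atom_below:
  fixes u :: "'a::lattice_ab_group_add_abs"
  assumes "lu_frame u" "compact_in {0..u} u" "0 < g" "g \<le> u"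
  obtains p where "atom p" "p \<le> g"
proof -
  obtain m where m: "m \<in> {0..<g}" and max: "\<And>x. x \<in> {0..<g} \<Longrightarrow> m \<le> x \<Longrightarrow> x = m"
  proof (rule maximal_exists[OF assms(1,2), of "{0..<g}"])
    show "{0..<g} \<subseteq> {0..u}" "{0..<g} \<noteq> {}"
      using assms(3,4) by (auto intro: order_trans[OF order_less_imp_le])
  qed auto
  have "atom (g - m)"
    unfolding atom_def
  proof (intro conjI allI impI)
    show "0 < g - m"
      using m by simp
    fix y
    assume y: "0 \<le> y \<and> y \<le> g - m"
    show "y = 0 \<or> y = g - m"
    proof (rule disjCI)
      assume "y \<noteq> g - m"
      then have "m + y < g"
        using y by (simp add: order_less_le algebra_simps)
      then show "y = 0"
        using max[of "m + y"] y m by simp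
    qed
  qed
  moreover have "g - m \<le> g"
    using m by simp
  ultimately show ?thesis
    using that by blast
qed

text \<open>The supremum of all atoms is compact, so finitely many atoms \<open>F\<close> already
  reach it. An atom outside \<open>F\<close> is disjoint from the sum of \<open>F\<close>, yet lies
  below it.\<close>

lemma finite_atoms:
  fixes u :: "'a::lattice_ab_group_add_abs"
  assumes frame: "lu_frame u" and comp: "compact_in {0..u} u"
  shows "finite {p::'a. atom p}"
proof (cases "{p::'a. atom p} = {}")
  case False
  let ?A = "{p::'a. atom p}"
  have grp: "lu_group u" and u: "0 \<le> u"
    using frame by (auto simp: lu_frame_def lu_group_def)
  have A: "?A \<subseteq> {0..u}"
    using atom_le_unit[OF grp] by (auto simp: atom_def)
  then obtain s where s: "isLub {0..u} ?A s"
    using False by (rule lu_frame_isLub_interval[OF frame])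
  note sL = isLub_mem[OF s]
  obtain F t where F: "F \<subseteq> ?A" "finite F" "isLub {0..u} F t" "s \<le> t"
    using compact_in_interval_if_compact_top[OF u comp sL] A s
    unfolding compact_in_def by blast
  have nonneg: "0 \<le> q" if "q \<in> F" for q
    using that F(1) by (auto simp: atom_def)
  have "p \<in> F" if p: "atom p" for p :: 'a
  proof (rule ccontr)
    assume "p \<notin> F"
    then have "inf p q = 0" if "q \<in> F" for q
      using that p F(1) by (intro inf_atoms_eq_0) auto
    moreover have "0 \<le> p"
      using p by (simp add: atom_def order_less_imp_le)
    ultimately have "inf p (\<Sum>F) = 0"
      using nonneg by (intro inf_sum_eq_0)
    \<comment> \<open>The sum of \<open>F\<close> may fail to lie below \<open>u\<close>; its meet
      with \<open>u\<close> is an upper bound of \<open>F\<close> inside the interval, where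
      \<open>t\<close> is the least one.\<close>
    moreover have "t \<le> inf (\<Sum>F) u"
    proof (rule isLub_leI[OF F(3)])
      show "inf (\<Sum>F) u \<in> {0..u}"
        using u nonneg by (auto intro: sum_nonneg)
      show "q \<le> inf (\<Sum>F) u" if "q \<in> F" for q
      proof (rule inf_greatest)
        show "q \<le> \<Sum>F"
          using sum_mono2[of F "{q}" "\<lambda>x. x"] that F(2) nonneg by simp
        show "q \<le> u"
          using that F(1) A by (meson atLeastAtMost_iff subsetD)
      qed
    qed
    then have "p \<le> \<Sum>F"
      using isLub_ge[OF s, of p] p F(4) by (meson inf.boundedE mem_Collect_eq order_trans)
    ultimately have "p = 0"
      by (simp add: inf_absorb1)
    then show False
      using p by (simp add: atom_def)
  qed
  then have "?A \<subseteq> F"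
    by auto
  then show ?thesis
    using F(2) finite_subset by blast
qed simp

section \<open>Integer combinations of atoms\<close>

text \<open>Iterated sums match the multiples in \<open>lu_group\<close>. As \<open>nat\<close>
  sends negative integers to \<open>0\<close>, at most one of the two sums is nonempty.\<close>

definition int_mult :: "int \<Rightarrow> 'a::ab_group_add \<Rightarrow> 'a" where
  "int_mult k x = (\<Sum>i<nat k. x) - (\<Sum>i<nat (- k). x)"

lemma sum_lessThan_const_add:
  fixes x :: "'a::comm_monoid_add" and m n :: nat
  shows "(\<Sum>i<m + n. x) = (\<Sum>i<m. x) + (\<Sum>i<n. x)"
  by (induction n) (auto simp: add.assoc)

text \<open>Independence of how \<open>k\<close> is written as a difference of naturals spares
  \<open>int_mult_add\<close> a case split on signs.\<close>

lemma int_mult_eq: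
  fixes x :: "'a::ab_group_add"
  assumes "k = int m - int n"
  shows "int_mult k x = (\<Sum>i<m. x) - (\<Sum>i<n. x)"
proof -
  have "nat k + n = m + nat (- k)"
    using assms by simp
  then have "(\<Sum>i<nat k. x) + (\<Sum>i<n. x) = (\<Sum>i<m. x) + (\<Sum>i<nat (- k). x)"
    by (metis sum_lessThan_const_add)
  then show ?thesis
    by (simp add: int_mult_def algebra_simps)
qed

lemma int_mult_1 [simp]: "int_mult 1 x = x"
  by (simp add: int_mult_def)

lemma int_mult_0 [simp]: "int_mult 0 x = 0"
  by (simp add: int_mult_def)

lemma int_mult_add: "int_mult (j + k) x = int_mult j x + int_mult k x"
proof -
  have "int_mult (j + k) x
      = (\<Sum>i<nat j + nat k. x) - (\<Sum>i<nat (- j) + nat (- k). x)"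
    by (rule int_mult_eq) simp
  then show ?thesis
    by (simp add: sum_lessThan_const_add int_mult_def algebra_simps)
qed

lemma int_mult_diff: "int_mult (j - k) x = int_mult j x - int_mult k x"
  using int_mult_add[of "j - k" k x] by (simp add: algebra_simps)

lemma int_mult_minus: "int_mult (- k) x = - int_mult k x"
  by (simp add: int_mult_def)

lemma int_mult_nonneg:
  fixes x :: "'a::lattice_ab_group_add"
  shows "0 \<le> k \<Longrightarrow> 0 \<le> x \<Longrightarrow> 0 \<le> int_mult k x"
  by (simp add: int_mult_def sum_nonneg)

definition int_comb :: "'a::ab_group_add set \<Rightarrow> ('a \<Rightarrow> int) \<Rightarrow> 'a" where
  "int_comb A f = (\<Sum>p\<in>A. int_mult (f p) p)"

lemma int_comb_add: "int_comb A (\<lambda>p. f p + g p) = int_comb A f + int_comb A g"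
  by (simp add: int_comb_def int_mult_add sum.distrib)

lemma int_comb_diff: "int_comb A (\<lambda>p. f p - g p) = int_comb A f - int_comb A g"
  by (simp add: int_comb_def int_mult_diff sum_subtractf)

lemma int_comb_restrict [simp]: "int_comb A (restrict f A) = int_comb A f"
  by (simp add: int_comb_def)

lemma int_comb_single:
  assumes "finite A" "p \<in> A"
  shows "int_comb A (\<lambda>q. if q = p then 1 else 0) = p"
proof -
  have "int_comb A (\<lambda>q. if q = p then 1 else 0) = (\<Sum>q\<in>A. if q = p then q else 0)"
    unfolding int_comb_def by (rule sum.cong) auto
  then show ?thesis
    using assms by simp
qed

text \<open>If the coefficient at \<open>q\<close> were negative, the positive parts
  \<open>P\<close> of the other terms would have to outweigh \<open>q\<close>. But \<open>P\<close>
  is a sum of atoms other than \<open>q\<close>, hence disjoint from \<open>q\<close>.\<close>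

lemma int_comb_nonneg_iff:
  fixes A :: "'a::lattice_ab_group_add set"
  assumes "finite A" and atoms: "\<And>p. p \<in> A \<Longrightarrow> atom p"
  shows "0 \<le> int_comb A f \<longleftrightarrow> (\<forall>p\<in>A. 0 \<le> f p)"
proof
  assume nonneg: "0 \<le> int_comb A f"
  have pos: "0 \<le> p" if "p \<in> A" for p
    using atoms[OF that] by (simp add: atom_def order_less_imp_le)
  show "\<forall>p\<in>A. 0 \<le> f p"
  proof (rule ballI, rule ccontr)
    fix q
    assume q: "q \<in> A" and "\<not> 0 \<le> f q"
    define P where "P = (\<Sum>p\<in>A - {q}. \<Sum>i<nat (f p). p)"
    \<comment> \<open>A negative integer is at most \<open>- 1\<close>, so the term at
      \<open>q\<close> is at most \<open>- q\<close>.\<close>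
    have "0 \<le> int_mult (- 1 - f q) q"
      using \<open>\<not> 0 \<le> f q\<close> pos[OF q] by (intro int_mult_nonneg) auto
    then have 1: "int_mult (f q) q \<le> - q"
      by (simp add: int_mult_diff int_mult_minus[of 1, simplified] algebra_simps)
    have 2: "(\<Sum>p\<in>A - {q}. int_mult (f p) p) \<le> P"
      unfolding P_def by (rule sum_mono) (simp add: int_mult_def sum_nonneg pos)
    have "inf q P = 0"
      unfolding P_def using q pos
      by (intro inf_sum_eq_0) (auto intro!: sum_nonneg inf_atoms_eq_0 atoms)
    moreover have "int_comb A f = int_mult (f q) q + (\<Sum>p\<in>A - {q}. int_mult (f p) p)"
      unfolding int_comb_def using assms(1) q by (rule sum.remove)
    then have "0 \<le> - q + P"
      using nonneg add_mono[OF 1 2] by (simp only:)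
    then have "q \<le> P"
      by (simp add: algebra_simps)
    ultimately have "q = 0"
      by (simp add: inf_absorb1)
    then show False
      using atoms[OF q] by (simp add: atom_def)
  qed
next
  assume "\<forall>p\<in>A. 0 \<le> f p"
  then show "0 \<le> int_comb A f"
    unfolding int_comb_def using atoms
    by (intro sum_nonneg int_mult_nonneg) (auto simp: atom_def order_less_imp_le)
qed

text \<open>By antisymmetry this also makes the coefficients on \<open>A\<close> unique, that is,
  the atoms are free generators of their span.\<close>

lemma int_comb_le_iff:
  fixes A :: "'a::lattice_ab_group_add set"
  assumes "finite A" "\<And>p. p \<in> A \<Longrightarrow> atom p"
  shows "int_comb A f \<le> int_comb A g \<longleftrightarrow> (\<forall>p\<in>A. f p \<le> g p)"
  using int_comb_nonneg_iff[OF assms, where f = "\<lambda>p. g p - f p"] by (simp add: int_comb_diff)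

text \<open>The range is a subgroup containing the atoms. If \<open>m\<close> is maximal in it below
  some \<open>x\<close> in \<open>{0..u}\<close> and differs from \<open>x\<close>, an atom below
  \<open>x - m\<close> can be added to \<open>m\<close>. Multiples of \<open>u\<close> then exhaust
  the positive elements.\<close>

lemma int_comb_surj:
  fixes u :: "'a::lattice_ab_group_add_abs"
  assumes frame: "lu_frame u" and comp: "compact_in {0..u} u"
  shows "g \<in> range (int_comb {p::'a. atom p})"
proof -
  let ?A = "{p::'a. atom p}"
  let ?R = "range (int_comb ?A)"
  have grp: "lu_group u" and u: "0 \<le> u"
    using frame by (auto simp: lu_frame_def lu_group_def)
  have R_add: "x + y \<in> ?R" and R_diff: "x - y \<in> ?R" if "x \<in> ?R" "y \<in> ?R" for x y
    using that by (auto simp flip: int_comb_add int_comb_diff)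
  have R_atom: "p \<in> ?R" if "atom p" for p
    using int_comb_single[OF finite_atoms[OF assms], of p] that by (metis mem_Collect_eq rangeI)
  have "int_comb ?A (\<lambda>_. 0) = 0"
    by (simp add: int_comb_def)
  then have R_0: "0 \<in> ?R"
    by (metis rangeI)
  have R_interval: "x \<in> ?R" if x: "0 \<le> x" "x \<le> u" for x
  proof -
    let ?Q = "?R \<inter> {0..x}"
    have "?Q \<subseteq> {0..u}" "?Q \<noteq> {}"
      using x R_0 by (auto intro: order_trans)
    then obtain m where m: "m \<in> ?Q" and max: "\<And>y. y \<in> ?Q \<Longrightarrow> m \<le> y \<Longrightarrow> y = m"
      by (meson maximal_exists[OF assms])
    have "x = m"
    proof (rule ccontr)
      assume "x \<noteq> m"
      then have "0 < x - m"
        using m by (simp add: order_less_le)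
      moreover have "x - m \<le> u"
        using m x by (simp add: diff_le_eq add_increasing2)
      ultimately obtain p where p: "atom p" "p \<le> x - m"
        by (rule atom_below[OF assms])
      then have "m + p \<in> ?Q"
        using m R_add R_atom by (auto simp: atom_def algebra_simps)
      then have "p = 0"
        using max[of "m + p"] p by (auto simp: atom_def)
      then show False
        using p by (simp add: atom_def)
    qed
    then show ?thesis
      using m by auto
  qed
  have R_multiple: "x \<in> ?R" if "0 \<le> x" "x \<le> (\<Sum>i<n. u)" for x and n :: nat
    using that
  proof (induction n arbitrary: x)
    case 0
    then show ?case
      using R_0 by simp
  next
    case (Suc n)
    have "x - inf x u \<le> (\<Sum>i<n. u)"
    proof -
      \<comment> \<open>Splitting off \<open>inf x u\<close>, which lies in the unit interval,
        leaves the positive part of \<open>x - u\<close>, and this needs one multiple of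
        \<open>u\<close> fewer.\<close>
      have "x - inf x u = sup 0 (x - u)"
        by (simp add: diff_inf_eq_sup add_sup_distrib_left)
      also have "\<dots> \<le> (\<Sum>i<n. u)"
        using Suc.prems u by (auto simp: diff_le_eq intro: sum_nonneg)
      finally show ?thesis .
    qed
    then have "x - inf x u \<in> ?R"
      by (intro Suc.IH) (simp_all only: diff_ge_0_iff_ge inf_le1)
    moreover have "inf x u \<in> ?R"
      using Suc.prems u by (intro R_interval) auto
    ultimately show ?case
      using R_add[of "x - inf x u" "inf x u"] by (simp only: diff_add_cancel)
  qed
  have R_pos: "x \<in> ?R" if x: "0 \<le> x" for x
  proof -
    obtain n :: nat where "\<bar>x\<bar> \<le> (\<Sum>i<n. u)"
      using grp unfolding lu_group_def by blast
    then show ?thesis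
      using R_multiple x by simp
  qed
  \<comment> \<open>This writes \<open>g\<close> as a difference of two nonnegative
    elements.\<close>
  have "\<bar>g\<bar> - (\<bar>g\<bar> - g) \<in> ?R"
    by (intro R_diff R_pos) (simp_all only: abs_ge_zero diff_ge_0_iff_ge abs_ge_self)
  then show ?thesis
    by simp
qed

text \<open>The atoms serve as the index set and the coordinates invert \<open>int_comb\<close>.
  Since the order is coordinatewise, suprema and infima are too.\<close>

lemma iso_int_power_if_compact_unit:
  fixes u :: "'a::lattice_ab_group_add_abs"
  assumes frame: "lu_frame u" and comp: "compact_in {0..u} u"
  shows "\<exists>(X :: 'a set) n. (\<forall>x\<in>X. 0 < n x) \<and> iso_to_int_power u X n"
proof -
  let ?A = "{p::'a. atom p}"
  let ?E = "?A \<rightarrow>\<^sub>E (UNIV :: int set)"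
  note fin = finite_atoms[OF assms]
  have le_iff: "int_comb ?A f \<le> int_comb ?A g \<longleftrightarrow> (\<forall>p\<in>?A. f p \<le> g p)" for f g
    using fin by (rule int_comb_le_iff) simp
  have inj: "inj_on (int_comb ?A) ?E"
  proof (rule inj_onI)
    fix f g
    assume fg: "f \<in> ?E" "g \<in> ?E" and "int_comb ?A f = int_comb ?A g"
    then have "\<forall>p\<in>?A. f p = g p"
      using le_iff[of f g] le_iff[of g f] by (auto intro: antisym)
    then show "f = g"
      using fg by (intro PiE_ext) auto
  qed
  have "g \<in> int_comb ?A ` ?E" for g
  proof -
    obtain f where "g = int_comb ?A f"
      using int_comb_surj[OF assms] by blast
    then show ?thesis
      by (intro image_eqI[of _ _ "restrict f ?A"]) auto
  qed
  then have bij: "bij_betw (int_comb ?A) ?E UNIV"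
    using inj by (auto simp: bij_betw_def)
  define \<phi> where "\<phi> = inv_into ?E (int_comb ?A)"
  have comb_\<phi>: "int_comb ?A (\<phi> a) = a" for a
    unfolding \<phi>_def using bij by (simp add: bij_betw_inv_into_right)
  have \<phi>_comb: "\<phi> (int_comb ?A f) = restrict f ?A" for f
    unfolding \<phi>_def using bij_betw_inv_into_left[OF bij, of "restrict f ?A"] by simp
  have \<phi>_le: "a \<le> b \<longleftrightarrow> (\<forall>p\<in>?A. \<phi> a p \<le> \<phi> b p)" for a b
    using le_iff[of "\<phi> a" "\<phi> b"] by (simp add: comb_\<phi>)
  have ext: "restrict (\<phi> a) ?A = \<phi> a" for a
    using \<phi>_comb[of "\<phi> a"] by (simp add: comb_\<phi>)
  have \<phi>_add: "\<phi> (a + b) = (\<lambda>p\<in>?A. \<phi> a p + \<phi> b p)" for a b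
    using \<phi>_comb[of "\<lambda>p. \<phi> a p + \<phi> b p"] by (simp add: int_comb_add comb_\<phi>)
  have \<phi>_sup: "\<phi> (sup a b) = (\<lambda>p\<in>?A. sup (\<phi> a p) (\<phi> b p))" for a b
  proof -
    let ?h = "\<lambda>p. sup (\<phi> a p) (\<phi> b p)"
    have "sup a b = int_comb ?A ?h"
    proof (rule antisym)
      show "sup a b \<le> int_comb ?A ?h"
        by (intro sup_least; subst \<phi>_le) (auto simp: \<phi>_comb)
      show "int_comb ?A ?h \<le> sup a b"
        using \<phi>_le[of a "sup a b"] \<phi>_le[of b "sup a b"] by (subst \<phi>_le) (auto simp: \<phi>_comb)
    qed
    then show ?thesis
      by (simp add: \<phi>_comb)
  qed
  have \<phi>_inf: "\<phi> (inf a b) = (\<lambda>p\<in>?A. inf (\<phi> a p) (\<phi> b p))" for a b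
  proof -
    let ?h = "\<lambda>p. inf (\<phi> a p) (\<phi> b p)"
    have "inf a b = int_comb ?A ?h"
    proof (rule antisym)
      show "int_comb ?A ?h \<le> inf a b"
        by (intro inf_greatest; subst \<phi>_le) (auto simp: \<phi>_comb)
      show "inf a b \<le> int_comb ?A ?h"
        using \<phi>_le[of "inf a b" a] \<phi>_le[of "inf a b" b] by (subst \<phi>_le) (auto simp: \<phi>_comb)
    qed
    then show ?thesis
      by (simp add: \<phi>_comb)
  qed
  have "0 < \<phi> u p" if "p \<in> ?A" for p
  proof -
    \<comment> \<open>An atom has the indicator of itself as coordinates, so
      \<open>p \<le> u\<close> makes the coordinate of \<open>u\<close> at \<open>p\<close> at least
      \<open>1\<close>.\<close>
    have "\<phi> p = (\<lambda>q\<in>?A. if q = p then 1 else 0)"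
      using \<phi>_comb int_comb_single[OF fin that] by metis
    moreover have "p \<le> u"
      using atom_le_unit[of u p] that frame by (simp add: lu_frame_def)
    then have "\<phi> p p \<le> \<phi> u p"
      using \<phi>_le[of p u] that by blast
    ultimately show ?thesis
      using that by simp
  qed
  moreover have "lu_iso_int_power u ?A (\<phi> u) \<phi>"
    unfolding lu_iso_int_power_def using bij_betw_inv_into[OF bij]
    by (simp add: \<phi>_add \<phi>_sup \<phi>_inf ext flip: \<phi>_def)
  ultimately show ?thesis
    unfolding iso_to_int_power_def by blast
qed

section \<open>Powers of the integers\<close>

text \<open>A diagonal argument: over an infinite index set some element grows faster, relative to
  \<open>n\<close>, than every fixed multiple of the unit.\<close>

lemma finite_index_if_lu_iso:
  fixes u :: "'a::lattice_ab_group_add_abs"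
  assumes "lu_group u" "\<And>x. x \<in> X \<Longrightarrow> 0 < n x" and iso: "lu_iso_int_power u X n \<phi>"
  shows "finite X"
proof (rule ccontr)
  assume "infinite X"
  then obtain e :: "nat \<Rightarrow> 'b" where e: "inj e" "range e \<subseteq> X"
    using infinite_countable_subset by blast
  have \<phi>_u: "\<phi> u = (\<lambda>x\<in>X. n x)"
    and surj: "\<phi> ` UNIV = X \<rightarrow>\<^sub>E UNIV"
    and add: "\<phi> (a + b) = (\<lambda>x\<in>X. \<phi> a x + \<phi> b x)" for a b
    using iso by (auto simp: lu_iso_int_power_def bij_betw_def)
  have zero: "\<phi> 0 x = 0" if "x \<in> X" for x
    using fun_cong[OF add[of 0 0], of x] that by simp
  have multiple: "\<phi> (\<Sum>i<k. u) x = int k * n x" if "x \<in> X" for x and k :: nat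
    using that by (induction k) (auto simp: zero add \<phi>_u algebra_simps)
  \<comment> \<open>At \<open>e k\<close> the value is \<open>k + 1\<close> times the unit, just
    beyond the multiple \<open>k\<close>. Outside \<open>range e\<close> the values of
    \<open>inv e\<close> are arbitrary, but only coordinates \<open>e k\<close> are
    inspected.\<close>
  have "(\<lambda>x\<in>X. (int (inv e x) + 1) * n x) \<in> \<phi> ` UNIV"
    unfolding surj by simp
  then obtain a where a: "\<phi> a = (\<lambda>x\<in>X. (int (inv e x) + 1) * n x)"
    by auto
  obtain k :: nat where "\<bar>a\<bar> \<le> (\<Sum>i<k. u)"
    using assms(1) unfolding lu_group_def by blast
  then have "a \<le> (\<Sum>i<k. u)"
    using abs_ge_self order_trans by blast
  moreover have ek: "e k \<in> X"
    using e by auto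
  ultimately have "\<phi> a (e k) \<le> int k * n (e k)"
    using multiple lu_iso_int_power_le_iff[OF iso] by metis
  then have "(int k + 1) * n (e k) \<le> int k * n (e k)"
    using ek e(1) by (simp add: a)
  then show False
    using assms(2)[OF ek] by (simp add: algebra_simps)
qed

text \<open>The isomorphism embeds the interval into a finite product of finite integer
  intervals.\<close>

lemma finite_interval_if_lu_iso:
  fixes u a b :: "'a::lattice_ab_group_add_abs"
  assumes "finite X" and iso: "lu_iso_int_power u X n \<phi>"
  shows "finite {a..b}"
proof (rule inj_on_finite)
  have bij: "bij_betw \<phi> UNIV (X \<rightarrow>\<^sub>E UNIV)"
    using iso by (simp add: lu_iso_int_power_def)
  then show "inj_on \<phi> {a..b}"
    by (auto simp: bij_betw_def intro: inj_on_subset)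
  show "\<phi> ` {a..b} \<subseteq> (\<Pi>\<^sub>E x\<in>X. {\<phi> a x..\<phi> b x})"
    using bij_betwE[OF bij] lu_iso_int_power_le_iff[OF iso] by (fastforce simp: PiE_iff)
  show "finite (\<Pi>\<^sub>E x\<in>X. {\<phi> a x..\<phi> b x})"
    using assms(1) by (intro finite_PiE) auto
qed

lemma algebraic_if_iso_to_int_power:
  fixes u :: "'a::lattice_ab_group_add_abs"
  assumes "lu_group u" "\<forall>x\<in>X. 0 < n x" "iso_to_int_power u X n"
  shows "algebraic_lu u"
proof -
  obtain \<phi> where iso: "lu_iso_int_power u X n \<phi>"
    using assms(3) by (auto simp: iso_to_int_power_def)
  have "finite X"
    using assms(2) by (intro finite_index_if_lu_iso[OF assms(1) _ iso]) blast
  then have fin: "finite {0..u}"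
    using iso finite_interval_if_lu_iso by blast
  have "compact_in {0..u} a" if "a \<in> {0..u}" for a
    unfolding compact_in_def
  proof (intro conjI allI impI that)
    fix S s
    assume "S \<subseteq> {0..u} \<and> isLub {0..u} S s \<and> a \<le> s"
    \<comment> \<open>Here \<open>S\<close> is itself finite, so \<open>F = S\<close> and
      \<open>t = s\<close> are witnesses.\<close>
    then show "\<exists>F t. F \<subseteq> S \<and> finite F \<and> isLub {0..u} F t \<and> a \<le> t"
      using finite_subset[OF _ fin] by blast
  qed
  then have "compact_elements u = UNIV"
    using assms(1) by (auto simp: compact_elements_def lu_group_def)
  \<comment> \<open>Each \<open>g\<close> is now the greatest member of its own set of compact
    elements.\<close>
  then show ?thesis
    unfolding algebraic_lu_def by (auto intro: isLub_I)
qed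

text \<open>Index sets in the carrier type suffice for the equivalence because the indices
  constructed are atoms; the second conjunct extends the converse to index sets of any type.\<close>

theorem theorem4p5:
  fixes u :: "'a::lattice_ab_group_add_abs"
  assumes "lu_frame u"
  shows "(algebraic_lu u \<longleftrightarrow>
            (\<exists>(X :: 'a set) n. (\<forall>x\<in>X. 0 < n x) \<and> iso_to_int_power u X n)) \<and>
         (\<forall>(X :: 'x set) n. (\<forall>x\<in>X. 0 < n x) \<and> iso_to_int_power u X n \<longrightarrow> algebraic_lu u)"
proof -
  have grp: "lu_group u"
    using assms by (simp add: lu_frame_def)
  then have "0 \<le> u"
    by (simp add: lu_group_def)
  then have "\<exists>(X :: 'a set) n. (\<forall>x\<in>X. 0 < n x) \<and> iso_to_int_power u X n" if "algebraic_lu u"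
    using that by (intro iso_int_power_if_compact_unit[OF assms] compact_unit_if_algebraic)
  moreover note algebraic_if_iso_to_int_power[OF grp]
  ultimately show ?thesis
    by metis
qed

end
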